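(* Let $p\neq 5$ be an odd prime and $q$ a power of $p$. Let $\xi_\kappa,\xi_\lambda$ be primitive $10$-th roots of unity in $GF(q)$ or $GF(q^2)$, and let $\omega_\kappa=\xi_\kappa+\xi_\kappa^{-1}$, $\omega_\lambda=\xi_\lambda+\xi_\lambda^{-1}$. Put $D=\omega_\kappa^2+\omega_\lambda^2-4$ and $\eta=(\xi_\kappa-\xi_\kappa^{-1})^{-1}$. Then the group $\langle R,S\rangle$ of the regular map of type $(5,5)$, generated by (the classes up to scalars of) the matrices $$R=\begin{pmatrix}\xi_\kappa&0\\0&\xi_\kappa^{-1}\end{pmatrix},\qquad S=\eta\begin{pmatrix}-\omega_\lambda\xi_\kappa^{-1}&-D\\1&\omega_\lambda\xi_\kappa\end{pmatrix},$$ is isomorphic to the alternating group $A_5$ if and only if $\omega_\lambda\neq\omega_\kappa$.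
   Context: Matrices are regarded up to nonzero scalar multiples, i.e. as elements of $PGL(2,K)$ with $K$ an algebraic closure of $GF(p)$. The elements $R$ and $S$ represent the rotations of the map around a vertex and around a face; they have order $5$ and $RS$ has order $2$. *)

theory Defs
  imports
    "HOL-Analysis.Cartesian_Space"
    "HOL-Analysis.Determinants"
    "HOL-Algebra.Generated_Groups"
    "HOL-Algebra.Sym_Groups"
    "HOL-Algebra.Algebraic_Closure_Type"
begin

abbreviation field_ring :: "'k::field ring"
  where "field_ring \<equiv> ring_of_type_algebra"

text \<open>
  A field has at most one subfield with \<open>n\<close> elements (the roots of \<open>X ^ n - X\<close>), so the union
  below is that subfield, and it is empty if there is none. In particular
  \<open>algebraic_closure field_ring (GF p)\<close> entails that \<open>GF p\<close> is a subfield with \<open>p\<close> elements.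
\<close>

definition GF :: "nat \<Rightarrow> 'k::field set"
  where "GF n = \<Union> {F. subfield F field_ring \<and> finite F \<and> card F = n}"

definition primitive_root_of_unity :: "nat \<Rightarrow> 'k::field \<Rightarrow> bool"
  where "primitive_root_of_unity n x \<longleftrightarrow>
    n > 0 \<and> x ^ n = 1 \<and> (\<forall>m. 0 < m \<and> m < n \<longrightarrow> x ^ m \<noteq> 1)"

definition GL2 :: "('k::field ^ 2 ^ 2) monoid"
  where "GL2 = \<lparr>carrier = {A. invertible A}, monoid.mult = (**), one = mat 1\<rparr>"

definition scalars2 :: "('k::field ^ 2 ^ 2) set"
  where "scalars2 = {mat c | c. c \<noteq> 0}"

definition PGL2 :: "('k::field ^ 2 ^ 2) set monoid"
  where "PGL2 = GL2 Mod scalars2"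

definition proj_class :: "'k::field ^ 2 ^ 2 \<Rightarrow> ('k ^ 2 ^ 2) set"
  where "proj_class A = scalars2 #>\<^bsub>GL2\<^esub> A"

definition rotation_group :: "'k::field ^ 2 ^ 2 \<Rightarrow> 'k ^ 2 ^ 2 \<Rightarrow> ('k ^ 2 ^ 2) set monoid"
  where "rotation_group R S =
    PGL2 \<lparr>carrier := generate PGL2 {proj_class R, proj_class S}\<rparr>"

lemma group_GL2: "group (GL2 :: ('k::field ^ 2 ^ 2) monoid)"
proof (rule groupI)
  fix A :: "'k ^ 2 ^ 2"
  assume "A \<in> carrier GL2"
  then show "\<exists>B\<in>carrier GL2. B \<otimes>\<^bsub>GL2\<^esub> A = \<one>\<^bsub>GL2\<^esub>"
    by (auto simp: GL2_def invertible_def)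
qed (auto simp: GL2_def matrix_mul_assoc invertible_mult, auto simp: invertible_def)

lemma mat_mult_mat: "mat c ** mat d = (mat (c * d) :: 'k::field ^ 2 ^ 2)"
  by (simp add: vec_eq_iff forall_2 matrix_matrix_mult_def mat_def sum_2)

lemma mat_mult_commute: "mat c ** A = (A :: 'k::field ^ 2 ^ 2) ** mat c"
  by (simp add: vec_eq_iff forall_2 matrix_matrix_mult_def mat_def sum_2)

lemma scalars2_subset: "scalars2 \<subseteq> carrier (GL2 :: ('k::field ^ 2 ^ 2) monoid)"
proof -
  have "invertible (mat c :: 'k ^ 2 ^ 2)" if "c \<noteq> 0" for c
    unfolding invertible_def using that by (intro exI[of _ "mat (inverse c)"]) (simp add: mat_mult_mat)
  then show ?thesis
    by (auto simp: scalars2_def GL2_def)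
qed

lemma scalars2_normal: "scalars2 \<lhd> (GL2 :: ('k::field ^ 2 ^ 2) monoid)"
proof -
  interpret group "GL2 :: ('k ^ 2 ^ 2) monoid" by (rule group_GL2)
  have inv_in: "inv\<^bsub>GL2\<^esub> x \<in> scalars2" if x: "x \<in> scalars2" for x :: "'k ^ 2 ^ 2"
  proof -
    obtain c where c: "x = mat c" "c \<noteq> 0" using x by (auto simp: scalars2_def)
    have y: "mat (inverse c) \<in> (scalars2 :: ('k ^ 2 ^ 2) set)"
      using c by (auto simp: scalars2_def)
    have "mat (inverse c) \<otimes>\<^bsub>GL2\<^esub> x = \<one>\<^bsub>GL2\<^esub>"
      using c by (simp add: GL2_def mat_mult_mat)
    then have "inv\<^bsub>GL2\<^esub> x = mat (inverse c)"
      using inv_equality x y scalars2_subset by blast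
    then show ?thesis using y by simp
  qed
  have "subgroup scalars2 (GL2 :: ('k ^ 2 ^ 2) monoid)"
  proof (rule subgroupI)
    fix x y :: "'k ^ 2 ^ 2"
    assume "x \<in> scalars2" "y \<in> scalars2"
    then show "x \<otimes>\<^bsub>GL2\<^esub> y \<in> scalars2"
      by (force simp: scalars2_def GL2_def mat_mult_mat)
  qed (use scalars2_subset inv_in in \<open>auto simp: scalars2_def intro: exI[of _ 1]\<close>)
  moreover have "scalars2 #>\<^bsub>GL2\<^esub> x = x <#\<^bsub>GL2\<^esub> scalars2" for x :: "'k ^ 2 ^ 2"
    unfolding r_coset_def l_coset_def by (auto simp: scalars2_def GL2_def mat_mult_commute)
  ultimately show ?thesis
    by (intro normalI) auto
qed

lemma group_PGL2: "group (PGL2 :: ('k::field ^ 2 ^ 2) set monoid)"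
  unfolding PGL2_def by (rule normal.factorgroup_is_group[OF scalars2_normal])

end

theory Submission
  imports Defs
begin

text \<open>
  Write \<open>\<omega>\<close> for either of \<open>\<omega>\<^sub>\<kappa>\<close>, \<open>\<omega>\<^sub>\<lambda>\<close>; both are roots of \<open>X\<^sup>2 - X - 1\<close>, so they are equal or sum
  to \<open>1\<close>.

  If they differ, then \<open>D = -1\<close>. Klein's normal form of the icosahedral group applies: in terms of
  the diagonal rotation \<open>r = R\<close>, the involution \<open>t = R S\<close> and the antidiagonal involution \<open>u\<close>
  commuting with \<open>t\<close>, every element is \<open>r\<^sup>j u\<^sup>f\<close> or \<open>r\<^sup>i t r\<^sup>j u\<^sup>f\<close>, and the relations that move a further
  generator past such a word hold for suitable \<open>r, t, u\<close> in \<open>A\<^sub>5\<close> as well. In \<open>A\<^sub>5\<close> the \<open>60\<close> normal forms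
  are distinct, so the relations give a homomorphism from \<open>A\<^sub>5\<close> onto \<open>\<langle>R, S\<rangle>\<close>; only the trivial
  normal form is a scalar matrix.

  If they agree, then \<open>R\<^sup>-\<^sup>1 S\<close> has trace \<open>\<omega>\<^sup>2\<close> and determinant \<open>1\<close> up to scaling, and by Cayley-Hamilton
  none of its second, third and fifth powers is scalar; but every element of \<open>A\<^sub>5\<close> has one of these
  powers trivial.
\<close>

section \<open>Icosahedral relations and Klein's normal form of words\<close>

text \<open>The relations for \<open>t r^j t\<close> leave a single \<open>t\<close> on the right,
  so together with the others they rewrite every product of generators into normal form. Inverses of
  \<open>r\<close> are written as \<open>r^4\<close>, which keeps all exponents natural.\<close>

locale icosahedral_triple = group G for G (structure) +
  fixes r t u
  assumes closed [simp]: "r \<in> carrier G" "t \<in> carrier G" "u \<in> carrier G"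
    and r_pow_5: "r [^] (5::nat) = \<one>"
    and t_t: "t \<otimes> t = \<one>"
    and u_u: "u \<otimes> u = \<one>"
    and u_t: "u \<otimes> t = t \<otimes> u"
    and u_r: "u \<otimes> r = r [^] (4::nat) \<otimes> u"
    and t_r1_t: "t \<otimes> (r \<otimes> t) = r \<otimes> (t \<otimes> (r [^] (4::nat) \<otimes> u))"
    and t_r2_t: "t \<otimes> (r [^] (2::nat) \<otimes> t) = r [^] (3::nat) \<otimes> (t \<otimes> r [^] (3::nat))"
    and t_r3_t: "t \<otimes> (r [^] (3::nat) \<otimes> t) = r [^] (2::nat) \<otimes> (t \<otimes> r [^] (2::nat))"
    and t_r4_t: "t \<otimes> (r [^] (4::nat) \<otimes> t) = r [^] (4::nat) \<otimes> (t \<otimes> (r \<otimes> u))"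

text \<open>The index \<open>(i, e, j, f)\<close> encodes \<open>r\<^sup>i t\<^sup>e r\<^sup>j u\<^sup>f\<close>; requiring \<open>i = 0\<close> in words without \<open>t\<close> makes the
  encoding unique.\<close>

type_synonym bruhat_index = "nat \<times> bool \<times> nat \<times> bool"

definition bruhat_indices :: "bruhat_index set"
  where "bruhat_indices = {(i, e, j, f). i < 5 \<and> j < 5 \<and> (\<not> e \<longrightarrow> i = 0)}"

text \<open>The step functions describe right multiplication of a normal form by a generator. The
  summand \<open>j + 4\<close> comes from \<open>u r = r^4 u\<close>: moving \<open>r\<close> to the
  left of \<open>u\<close> inverts it.\<close>

fun step_r :: "bruhat_index \<Rightarrow> bruhat_index"
  where "step_r (i, e, j, f) = (i, e, (if f then j + 4 else j + 1) mod 5, f)"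

fun step_u :: "bruhat_index \<Rightarrow> bruhat_index"
  where "step_u (i, e, j, f) = (i, e, j, \<not> f)"

text \<open>A word without \<open>t\<close> keeps its exponent in the third place, so this exponent
  moves to the first place when \<open>t\<close> appears and back when \<open>t t\<close> cancels.
  The other cases transcribe the relations for \<open>t r^j t\<close>; \<open>f\<close> is flipped
  exactly where such a relation introduces \<open>u\<close>.\<close>

fun step_t :: "bruhat_index \<Rightarrow> bruhat_index"
  where "step_t (i, e, j, f) =
    (if \<not> e then (j, True, 0, f)
     else if j = 0 then (0, False, i, f)
     else if j = 1 then ((i + 1) mod 5, True, 4, \<not> f)
     else if j = 2 then ((i + 3) mod 5, True, 3, f)
     else if j = 3 then ((i + 2) mod 5, True, 2, f)
     else ((i + 4) mod 5, True, 1, \<not> f))"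

lemma step_closed:
  assumes "n \<in> bruhat_indices"
  shows "step_r n \<in> bruhat_indices" "step_t n \<in> bruhat_indices" "step_u n \<in> bruhat_indices"
  using assms by (cases n; auto simp: bruhat_indices_def split: if_splits)+

context icosahedral_triple
begin

fun bruhat :: "bruhat_index \<Rightarrow> 'a"
  where "bruhat (i, e, j, f) =
    r [^] i \<otimes> ((if e then t else \<one>) \<otimes> (r [^] j \<otimes> (if f then u else \<one>)))"

lemma bruhat_closed [simp]: "bruhat n \<in> carrier G"
  by (cases n) auto

lemma r_pow_mod: "r [^] (n mod 5) = r [^] (n::nat)"
proof -
  have "r [^] n = r [^] (5 * (n div 5) + n mod 5)" by simp
  also have "\<dots> = (r [^] (5::nat)) [^] (n div 5) \<otimes> r [^] (n mod 5)"
    by (simp only: nat_pow_mult[symmetric] nat_pow_pow closed)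
  finally show ?thesis by (simp add: r_pow_5)
qed

lemma bruhat_r: "bruhat n \<otimes> r = bruhat (step_r n)"
proof (cases n)
  case (fields i e j f)
  have "r [^] j \<otimes> (u \<otimes> r) = r [^] (j + 4) \<otimes> u"
    by (simp only: u_r nat_pow_mult[symmetric] m_assoc closed nat_pow_closed)
  then show ?thesis
    by (simp add: fields r_pow_mod m_assoc)
qed

lemma bruhat_u: "bruhat n \<otimes> u = bruhat (step_u n)"
  by (cases n) (auto simp: m_assoc u_u)

lemma bruhat_t:
  assumes "n \<in> bruhat_indices"
  shows "bruhat n \<otimes> t = bruhat (step_t n)"
proof (cases n)
  case (fields i e j f)
  \<comment> \<open>The optional trailing \<open>u\<close> commutes with \<open>t\<close>, so the
    new \<open>t\<close> can be moved in front of it. All cases containing \<open>t\<close> then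
    reduce to rewriting \<open>t r^j t\<close>, as isolated in \<open>main\<close>.\<close>
  define v where "v = (if f then u else \<one>)"
  have v: "v \<in> carrier G" "v \<otimes> t = t \<otimes> v" "u \<otimes> v = (if \<not> f then u else \<one>)"
    by (auto simp: v_def u_t u_u)
  have b: "bruhat (k, e', l, f) = r [^] k \<otimes> ((if e' then t else \<one>) \<otimes> (r [^] l \<otimes> v))"
    "bruhat (k, e', l, \<not> f) = r [^] k \<otimes> ((if e' then t else \<one>) \<otimes> (r [^] l \<otimes> (u \<otimes> v)))" for k e' l
    by (simp_all add: v(3)) (simp_all add: v_def)
  have main: "bruhat (i, True, j, f) \<otimes> t = r [^] i \<otimes> ((t \<otimes> (r [^] j \<otimes> t)) \<otimes> v)"
    by (simp add: b m_assoc v del: bruhat.simps)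
  consider "\<not> e" | "e" "j = 0" | "e" "j = 1" | "e" "j = 2" | "e" "j = 3" | "e" "j = 4"
    using assms fields unfolding bruhat_indices_def by fastforce
  then show ?thesis
  proof cases
    case 1
    then show ?thesis using assms v by (simp add: fields b m_assoc bruhat_indices_def del: bruhat.simps)
  next
    case 2
    then show ?thesis using main v by (simp add: fields b t_t del: bruhat.simps)
  next
    case 3
    then show ?thesis using main v
      by (simp add: fields b m_assoc t_r1_t r_pow_mod nat_pow_mult[symmetric] del: bruhat.simps nat_pow_Suc add_2_eq_Suc')
  next
    case 4
    then show ?thesis using main v
      by (simp add: fields b m_assoc t_r2_t r_pow_mod nat_pow_mult[symmetric] del: bruhat.simps nat_pow_Suc add_2_eq_Suc')
  next
    case 5
    then show ?thesis using main v
      by (simp add: fields b m_assoc t_r3_t r_pow_mod nat_pow_mult[symmetric] del: bruhat.simps nat_pow_Suc add_2_eq_Suc')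
  next
    case 6
    then show ?thesis using main v
      by (simp add: fields b m_assoc t_r4_t r_pow_mod nat_pow_mult[symmetric] del: bruhat.simps nat_pow_Suc add_2_eq_Suc')
  qed
qed

lemma subgroup_bruhat:
  assumes "subgroup H G" "r \<in> H" "t \<in> H" "u \<in> H"
  shows "bruhat n \<in> H"
proof (cases n)
  case (fields i e j f)
  interpret H: subgroup H G by (rule assms)
  have "r [^] k \<in> H" for k :: nat
    using assms by (induction k) auto
  then show ?thesis
    using assms by (simp add: fields)
qed

text \<open>The relation \<open>t r t = r t r\<^sup>4 u\<close> expresses \<open>u\<close> in terms of \<open>r\<close> and \<open>t\<close>.\<close>

lemma u_in_subgroup:
  assumes "subgroup H G" "r \<in> H" "t \<in> H"
  shows "u \<in> H"
proof -
  interpret H: subgroup H G by (rule assms)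
  have pw: "r [^] k \<in> H" for k :: nat
    using assms by (induction k) auto
  have "u = inv (r \<otimes> (t \<otimes> r [^] (4::nat))) \<otimes> (t \<otimes> (r \<otimes> t))"
    by (rule inv_solve_left[THEN iffD2]) (simp_all add: t_r1_t m_assoc)
  moreover have "\<dots> \<in> H"
    using assms pw by auto
  ultimately show ?thesis by simp
qed

end

section \<open>Transport of normal forms from one group to another\<close>

text \<open>\<open>H\<close> is the model in which normal forms are unique and exhaust the group.
  For \<open>G\<close> only a trivial kernel is demanded, in the shape of
  \<open>faithful\<close>.\<close>

locale icosahedral_pair = H: icosahedral_triple H r t u + G: icosahedral_triple G r' t' u'
  for H (structure) and r t u and G (structure) and r' t' u' +
  assumes bij: "bij_betw H.bruhat bruhat_indices (carrier H)"
    and faithful: "\<And>n. n \<in> bruhat_indices \<Longrightarrow> G.bruhat n = \<one>\<^bsub>G\<^esub> \<Longrightarrow> H.bruhat n = \<one>\<^bsub>H\<^esub>"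
begin

definition transport where "transport = G.bruhat \<circ> inv_into bruhat_indices H.bruhat"

lemma transport_bruhat: "n \<in> bruhat_indices \<Longrightarrow> transport (H.bruhat n) = G.bruhat n"
  using bij by (simp add: transport_def bij_betw_def)

lemma transport_mult_generator:
  assumes "x \<in> carrier H"
  shows "transport (x \<otimes>\<^bsub>H\<^esub> r) = transport x \<otimes>\<^bsub>G\<^esub> r'"
    "transport (x \<otimes>\<^bsub>H\<^esub> t) = transport x \<otimes>\<^bsub>G\<^esub> t'"
    "transport (x \<otimes>\<^bsub>H\<^esub> u) = transport x \<otimes>\<^bsub>G\<^esub> u'"
proof -
  obtain n where n: "n \<in> bruhat_indices" "x = H.bruhat n"
    using assms bij unfolding bij_betw_def by blast
  show "transport (x \<otimes>\<^bsub>H\<^esub> r) = transport x \<otimes>\<^bsub>G\<^esub> r'"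
    "transport (x \<otimes>\<^bsub>H\<^esub> t) = transport x \<otimes>\<^bsub>G\<^esub> t'"
    "transport (x \<otimes>\<^bsub>H\<^esub> u) = transport x \<otimes>\<^bsub>G\<^esub> u'"
    using n by (simp_all add: transport_bruhat step_closed H.bruhat_r G.bruhat_r
        H.bruhat_t G.bruhat_t H.bruhat_u G.bruhat_u)
qed

lemma transport_hom: "group_hom H G transport"
proof -
  \<comment> \<open>\<open>Y\<close> collects the right factors on which \<open>transport\<close> is
    multiplicative. It contains the generators by the common step functions and is closed under
    products, hence contains all words.\<close>
  define Y where "Y = {y \<in> carrier H. transport y \<in> carrier G \<and>
    (\<forall>x\<in>carrier H. transport (x \<otimes>\<^bsub>H\<^esub> y) = transport x \<otimes>\<^bsub>G\<^esub> transport y)}"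
  have car: "transport x \<in> carrier G" for x
    by (simp add: transport_def)
  have one: "transport \<one>\<^bsub>H\<^esub> = \<one>\<^bsub>G\<^esub>"
    using transport_bruhat[of "(0, False, 0, False)"] by (simp add: bruhat_indices_def)
  have gen: "transport r = r'" "transport t = t'" "transport u = u'"
    using transport_mult_generator[OF H.one_closed] by (simp_all add: one)
  have mult: "x \<otimes>\<^bsub>H\<^esub> y \<in> Y" if "x \<in> Y" "y \<in> Y" for x y
    using that by (auto simp: Y_def car G.m_assoc H.m_assoc[symmetric])
  have Y1: "r \<in> Y" "t \<in> Y" "u \<in> Y" "\<one>\<^bsub>H\<^esub> \<in> Y"
    using transport_mult_generator by (auto simp: Y_def gen car one)
  have pow: "r [^]\<^bsub>H\<^esub> (k::nat) \<in> Y" for k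
    using Y1 mult by (induction k) auto
  have "H.bruhat n \<in> Y" for n
    using pow mult Y1 by (cases n) auto
  then have "carrier H \<subseteq> Y"
    using bij unfolding bij_betw_def by (metis image_subsetI)
  then have "transport \<in> hom H G"
    by (auto simp: hom_def Y_def)
  then show ?thesis
    by (simp add: group_hom_def group_hom_axioms_def H.group_axioms G.group_axioms)
qed

text \<open>The kernel of \<open>transport\<close> is trivial by \<open>faithful\<close>. Its image
  contains \<open>r'\<close> and \<open>s = r'^-1 t'\<close>; conversely every normal form lies in
  the subgroup they generate, since \<open>u'\<close> is a word in \<open>r'\<close> and
  \<open>t'\<close>.\<close>

lemma generate_iso:
  assumes "s \<in> carrier G" "t' = r' \<otimes>\<^bsub>G\<^esub> s"
  shows "G\<lparr>carrier := generate G {r', s}\<rparr> \<cong> H"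
proof -
  interpret f: group_hom H G transport by (rule transport_hom)
  have sub: "subgroup (generate G {r', s}) G"
    using assms by (intro G.generate_is_subgroup) auto
  interpret K: subgroup "generate G {r', s}" G by (rule sub)
  have "x = \<one>\<^bsub>H\<^esub>" if x: "x \<in> carrier H" "transport x = \<one>\<^bsub>G\<^esub>" for x
  proof -
    obtain n where n: "n \<in> bruhat_indices" "x = H.bruhat n"
      using x bij unfolding bij_betw_def by blast
    then show ?thesis using x faithful transport_bruhat by simp
  qed
  then have inj: "inj_on transport (carrier H)"
    by (intro f.inj_on_one_iff[THEN iffD2]) auto
  have img: "transport ` carrier H = G.bruhat ` bruhat_indices"
  proof -
    have "transport ` H.bruhat ` bruhat_indices = G.bruhat ` bruhat_indices"
      unfolding image_image by (intro image_cong refl transport_bruhat)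
    then show ?thesis using bij unfolding bij_betw_def by simp
  qed
  have r: "r' \<in> generate G {r', s}" and s: "s \<in> generate G {r', s}"
    by (auto intro: generate.incl)
  then have t: "t' \<in> generate G {r', s}" using assms by simp
  have r_img: "r' \<in> transport ` carrier H"
  proof -
    have "G.bruhat (0, False, 1, False) = r'" by simp
    moreover have "(0, False, 1, False) \<in> bruhat_indices" by (simp add: bruhat_indices_def)
    ultimately show ?thesis unfolding img by (metis image_eqI)
  qed
  have t_img: "t' \<in> transport ` carrier H"
  proof -
    have "G.bruhat (0, True, 0, False) = t'" by simp
    moreover have "(0, True, 0, False) \<in> bruhat_indices" by (simp add: bruhat_indices_def)
    ultimately show ?thesis unfolding img by (metis image_eqI)
  qed
  have img_sub: "subgroup (transport ` carrier H) G"
    by (rule f.img_is_subgroup)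
  have "s = inv\<^bsub>G\<^esub> r' \<otimes>\<^bsub>G\<^esub> t'"
    using assms by (simp add: G.m_assoc[symmetric])
  then have "s \<in> transport ` carrier H"
    using img_sub r_img t_img by (metis subgroup.m_closed subgroup.m_inv_closed)
  then have "generate G {r', s} \<subseteq> transport ` carrier H"
    using r_img img_sub by (intro G.generate_subgroup_incl) auto
  moreover have "transport ` carrier H \<subseteq> generate G {r', s}"
    unfolding img using G.subgroup_bruhat[OF sub r t G.u_in_subgroup[OF sub r t]] by auto
  ultimately have eq: "transport ` carrier H = generate G {r', s}" by blast
  have "transport \<in> iso H (G\<lparr>carrier := generate G {r', s}\<rparr>)"
    using inj eq by (auto simp: iso_def bij_betw_def hom_def)
  then show ?thesis
    using H.iso_sym is_isoI by blast
qed

end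

section \<open>The alternating group on five points as the model\<close>

text \<open>A 5-cycle, together with two commuting double transpositions fixing 1, of which
  \<open>alt_u\<close> inverts the 5-cycle. They are chosen to satisfy the same relations as the
  matrices.\<close>

definition alt_r :: "nat \<Rightarrow> nat" where "alt_r = cycle_of_list [1, 2, 3, 4, 5]"
definition alt_t :: "nat \<Rightarrow> nat" where "alt_t = cycle_of_list [2, 4] \<circ> cycle_of_list [3, 5]"
definition alt_u :: "nat \<Rightarrow> nat" where "alt_u = cycle_of_list [2, 5] \<circ> cycle_of_list [3, 4]"

lemma alt_generators_apply:
  "alt_r 1 = 2" "alt_r 2 = 3" "alt_r 3 = 4" "alt_r 4 = 5" "alt_r 5 = 1"
  "alt_t 1 = 1" "alt_t 2 = 4" "alt_t 3 = 5" "alt_t 4 = 2" "alt_t 5 = 3"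
  "alt_u 1 = 1" "alt_u 2 = 5" "alt_u 3 = 4" "alt_u 4 = 3" "alt_u 5 = 2"
  by (simp_all add: alt_r_def alt_t_def alt_u_def Transposition.transpose_def)

lemma alt_generators_in:
  "alt_r \<in> carrier (alt_group 5)" "alt_t \<in> carrier (alt_group 5)" "alt_u \<in> carrier (alt_group 5)"
  unfolding alt_group_carrier alt_r_def alt_t_def alt_u_def
  by (auto intro!: permutes_compose permutes_swap_id
      simp: evenperm_comp permutation_compose permutation_swap_id evenperm_swap)

lemma alt_group_pow: "p [^]\<^bsub>alt_group n\<^esub> (k::nat) = p ^^ k"
proof (induction k)
  interpret group "alt_group n" by (rule alt_group_is_group)
  case 0
  show ?case by (simp add: alt_group_one)
next
  interpret group "alt_group n" by (rule alt_group_is_group)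
  case (Suc k)
  then show ?case by (simp add: alt_group_mult funpow_swap1 fun_eq_iff)
qed

lemma alt_group_5_eqI:
  assumes "p \<in> carrier (alt_group 5)" "q \<in> carrier (alt_group 5)"
    and "\<forall>k\<in>set [1, 2, 3, 4, 5]. p k = q k"
  shows "p = q"
proof
  fix k :: nat
  have "k \<in> set [1, 2, 3, 4, 5]" if "k \<in> {1..5}"
    using that by auto
  then show "p k = q k"
    using assms unfolding alt_group_carrier by (cases "k \<in> {1..5}") (blast, metis permutes_not_in)
qed

lemma funpow_apply:
  "(f ^^ 0) k = k" "(f ^^ 1) k = f k" "(f ^^ 2) k = f (f k)" "(f ^^ 3) k = f (f (f k))"
  "(f ^^ 4) k = f (f (f (f k)))" "(f ^^ 5) k = f (f (f (f (f k))))"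
  by (simp_all add: numeral_eq_Suc)

lemma icosahedral_alt_group: "icosahedral_triple (alt_group 5) alt_r alt_t alt_u"
proof -
  interpret group "alt_group 5" by (rule alt_group_is_group)
  show ?thesis
    by unfold_locales
      (rule alt_generators_in | (rule alt_group_5_eqI, use alt_generators_in in force,
        use alt_generators_in in force,
        simp add: alt_group_pow alt_group_mult alt_group_one funpow_apply alt_generators_apply
          del: One_nat_def))+
qed

interpretation alt: icosahedral_triple "alt_group 5" alt_r alt_t alt_u
  by (rule icosahedral_alt_group)

text \<open>An explicit enumeration of the 60 indices, so that claims about all normal forms become
  finite computations for the simplifier.\<close>

definition index_list :: "bruhat_index list"
  where "index_list =
    map (\<lambda>(j, f). (0, False, j, f)) (List.product [0..<5] [True, False]) @
    map (\<lambda>(i, j, f). (i, True, j, f))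
      (List.product [0..<5] (List.product [0..<5] [True, False]))"

lemma set_index_list: "set index_list = bruhat_indices"
  by (auto simp: bruhat_indices_def index_list_def image_iff)

lemma upt_0_5: "[0..<5] = [0, 1, 2, 3, 4]"
  by (simp add: upt_rec)

lemma length_index_list: "length index_list = 60"
  by (simp add: index_list_def)

lemma alt_bruhat: "alt.bruhat = (\<lambda>(i, e, j, f) k.
    (alt_r ^^ i) ((if e then alt_t else id) ((alt_r ^^ j) ((if f then alt_u else id) k))))"
  by (auto simp: fun_eq_iff alt_group_pow alt_group_mult alt_group_one)

lemma distinct_alt_bruhat: "distinct (map (\<lambda>n. map (alt.bruhat n) [1, 2, 3, 4, 5]) index_list)"
  by (simp add: index_list_def upt_0_5 alt_bruhat funpow_apply alt_generators_apply
      del: One_nat_def alt.bruhat.simps)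

lemma alt_bruhat_orders:
  "\<forall>n\<in>set index_list. (\<forall>k\<in>set [1, 2, 3, 4, 5]. (alt.bruhat n ^^ 2) k = k) \<or>
    (\<forall>k\<in>set [1, 2, 3, 4, 5]. (alt.bruhat n ^^ 3) k = k) \<or>
    (\<forall>k\<in>set [1, 2, 3, 4, 5]. (alt.bruhat n ^^ 5) k = k)"
  by (simp add: index_list_def upt_0_5 alt_bruhat funpow_apply alt_generators_apply
      del: One_nat_def alt.bruhat.simps)

text \<open>The 60 normal forms differ already in their values on 1 to 5, and the group has 5!/2 =
  60 elements, so injectivity gives surjectivity.\<close>

lemma bij_alt_bruhat: "bij_betw alt.bruhat bruhat_indices (carrier (alt_group 5))"
proof -
  have d: "distinct index_list" and "inj_on (\<lambda>n. map (alt.bruhat n) [1, 2, 3, 4, 5]) (set index_list)"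
    using distinct_alt_bruhat by (simp_all only: distinct_map)
  then have inj: "inj_on alt.bruhat bruhat_indices"
    unfolding set_index_list
    by (intro inj_on_imageI2[of "\<lambda>g. map g [1, 2, 3, 4, 5]"]) (simp only: comp_def)
  have "card (alt.bruhat ` bruhat_indices) = 60"
    using card_image[OF inj] distinct_card[OF d] by (simp add: set_index_list length_index_list)
  moreover have "card (carrier (alt_group 5)) = 60"
    using alt_group_card_carrier[of 5] by (simp add: fact_numeral)
  ultimately have "alt.bruhat ` bruhat_indices = carrier (alt_group 5)"
    by (intro card_subset_eq) (auto intro: card_ge_0_finite simp del: alt.bruhat.simps)
  then show ?thesis
    using inj by (simp add: bij_betw_def)
qed

lemma alt_group_5_orders:
  assumes "p \<in> carrier (alt_group 5)"
  shows "\<exists>k\<in>{2, 3, 5 :: nat}. p [^]\<^bsub>alt_group 5\<^esub> k = \<one>\<^bsub>alt_group 5\<^esub>"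
proof -
  obtain n where n: "n \<in> bruhat_indices" "p = alt.bruhat n"
    using assms bij_alt_bruhat unfolding bij_betw_def by blast
  have "\<exists>k\<in>{2, 3, 5 :: nat}. \<forall>l\<in>set [1, 2, 3, 4, 5]. (p ^^ k) l = id l"
    using alt_bruhat_orders n unfolding set_index_list id_apply by blast
  then obtain k where k: "k \<in> {2, 3, 5 :: nat}"
    "\<forall>l\<in>set [1, 2, 3, 4, 5]. (p [^]\<^bsub>alt_group 5\<^esub> k) l = \<one>\<^bsub>alt_group 5\<^esub> l"
    unfolding alt_group_pow alt_group_one by blast
  have "p [^]\<^bsub>alt_group 5\<^esub> k = \<one>\<^bsub>alt_group 5\<^esub>"
    using assms k by (intro alt_group_5_eqI) auto
  then show ?thesis using k by blast
qed

section \<open>Two-by-two matrices and their projective classes\<close>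

definition mat2 :: "'k \<Rightarrow> 'k \<Rightarrow> 'k \<Rightarrow> 'k \<Rightarrow> 'k::field ^ 2 ^ 2"
  where "mat2 a b c d = vector [vector [a, b], vector [c, d]]"

lemma mat2_nth [simp]:
  "mat2 a b c d $ 1 $ 1 = a" "mat2 a b c d $ 1 $ 2 = b"
  "mat2 a b c d $ 2 $ 1 = c" "mat2 a b c d $ 2 $ 2 = d"
  by (simp_all add: mat2_def)

lemma mat2_eq_iff [simp]: "mat2 a b c d = mat2 a' b' c' d' \<longleftrightarrow> a = a' \<and> b = b' \<and> c = c' \<and> d = d'"
  by (auto simp: vec_eq_iff forall_2)

lemma mat2_mult:
  "mat2 a b c d ** mat2 a' b' c' d' =
    mat2 (a * a' + b * c') (a * b' + b * d') (c * a' + d * c') (c * b' + d * d')"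
  by (simp add: vec_eq_iff forall_2 matrix_matrix_mult_def sum_2)

lemma mat_eq_mat2: "mat k = mat2 k 0 0 k"
  by (simp add: vec_eq_iff forall_2 mat_def)

lemma mat_mult_mat2: "mat k ** mat2 a b c d = mat2 (k * a) (k * b) (k * c) (k * d)"
  by (simp add: mat_eq_mat2 mat2_mult)

lemma invertible_mat2: "invertible (mat2 a b c d) \<longleftrightarrow> a * d - b * c \<noteq> 0"
  by (simp add: invertible_det_nz det_2)

lemma carrier_GL2 [simp]: "A \<in> carrier GL2 \<longleftrightarrow> invertible A"
  and mult_GL2 [simp]: "A \<otimes>\<^bsub>GL2\<^esub> B = A ** B"
  by (simp_all add: GL2_def)

lemma proj_class_eq: "proj_class A = {mat k ** A |k. k \<noteq> 0}"
  by (auto simp: proj_class_def r_coset_def scalars2_def)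

lemma proj_class_closed: "invertible A \<Longrightarrow> proj_class A \<in> carrier PGL2"
  by (auto simp: proj_class_def PGL2_def FactGroup_def RCOSETS_def)

lemma proj_class_mult:
  "invertible A \<Longrightarrow> invertible B \<Longrightarrow> proj_class A \<otimes>\<^bsub>PGL2\<^esub> proj_class B = proj_class (A ** B)"
  unfolding PGL2_def FactGroup_def proj_class_def
  using normal.rcos_sum[OF scalars2_normal, of A B] by simp

lemma proj_class_one: "\<one>\<^bsub>PGL2\<^esub> = proj_class (mat 1)"
  by (auto simp: PGL2_def FactGroup_def proj_class_eq scalars2_def)

lemma proj_class_eqI: "B = mat k ** A \<Longrightarrow> k \<noteq> 0 \<Longrightarrow> proj_class A = proj_class B"
proof -
  assume B: "B = mat k ** A" and k: "k \<noteq> 0"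
  have "mat j ** A = mat (j / k) ** B" for j
    using k by (simp add: B matrix_mul_assoc mat_mult_mat)
  moreover have "mat j ** B = mat (j * k) ** A" for j
    by (simp add: B matrix_mul_assoc mat_mult_mat)
  ultimately show ?thesis
    using k unfolding proj_class_eq by (auto; metis divide_eq_0_iff mult_eq_0_iff)
qed

lemma proj_class_eqD: "proj_class A = proj_class B \<Longrightarrow> \<exists>k. k \<noteq> 0 \<and> B = mat k ** A"
proof -
  assume "proj_class A = proj_class B"
  moreover have "B \<in> proj_class B" unfolding proj_class_eq by (auto intro!: exI[of _ 1])
  ultimately show ?thesis unfolding proj_class_eq by auto
qed

lemma proj_class_eq_one_iff:
  "proj_class (mat2 a b c d) = \<one>\<^bsub>PGL2\<^esub> \<longleftrightarrow> a = d \<and> a \<noteq> 0 \<and> b = 0 \<and> c = 0"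
proof
  assume "proj_class (mat2 a b c d) = \<one>\<^bsub>PGL2\<^esub>"
  then obtain k where "k \<noteq> 0" "mat2 a b c d = mat k ** mat 1"
    using proj_class_eqD[of "mat 1" "mat2 a b c d"] by (auto simp: proj_class_one)
  then show "a = d \<and> a \<noteq> 0 \<and> b = 0 \<and> c = 0"
    by (simp add: mat_eq_mat2 mat2_mult)
next
  assume "a = d \<and> a \<noteq> 0 \<and> b = 0 \<and> c = 0"
  then show "proj_class (mat2 a b c d) = \<one>\<^bsub>PGL2\<^esub>"
    unfolding proj_class_one by (intro proj_class_eqI[symmetric, of _ a]) (auto simp: mat_eq_mat2 mat2_mult)
qed

lemma mat2_diag_pow:
  assumes "a \<noteq> 0" "b \<noteq> 0"
  shows "proj_class (mat2 a 0 0 b) [^]\<^bsub>PGL2\<^esub> (n::nat) = proj_class (mat2 (a ^ n) 0 0 (b ^ n))"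
proof (induction n)
  interpret group PGL2 by (rule group_PGL2)
  case 0
  show ?case by (simp add: proj_class_one mat_eq_mat2)
next
  interpret group PGL2 by (rule group_PGL2)
  case (Suc n)
  then show ?case
    using assms by (simp add: proj_class_mult invertible_mat2 mat2_mult mult.commute)
qed

text \<open>By Cayley--Hamilton the lower left entries of the powers of a matrix are multiples of \<open>c\<close>
  by Chebyshev polynomials in the trace.\<close>

lemma proj_class_powers_ne_one:
  assumes "a * d - b * c = \<delta>" "\<delta> \<noteq> 0" "a + d = \<tau>" "c \<noteq> 0"
    and "\<tau> \<noteq> 0" "\<tau>\<^sup>2 \<noteq> \<delta>" "\<tau> ^ 4 - 3 * \<tau>\<^sup>2 * \<delta> + \<delta>\<^sup>2 \<noteq> 0"
  defines "y \<equiv> proj_class (mat2 a b c d)"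
  shows "y [^]\<^bsub>PGL2\<^esub> (2::nat) \<noteq> \<one>\<^bsub>PGL2\<^esub>" "y [^]\<^bsub>PGL2\<^esub> (3::nat) \<noteq> \<one>\<^bsub>PGL2\<^esub>" "y [^]\<^bsub>PGL2\<^esub> (5::nat) \<noteq> \<one>\<^bsub>PGL2\<^esub>"
proof -
  interpret group PGL2 by (rule group_PGL2)
  define M where "M = mat2 a b c d"
  have inv: "invertible M" using assms by (simp add: M_def invertible_mat2)
  have cl: "proj_class M \<in> carrier PGL2" using inv by (rule proj_class_closed)
  \<comment> \<open>Cayley-Hamilton gives \<open>M^2 = \<tau> M - \<delta>\<close>, and hence
    \<open>M^3 = (\<tau>^2 - \<delta>) M - \<tau> \<delta>\<close>.\<close>
  have M2: "M ** M = mat2 (\<tau> * a - \<delta>) (\<tau> * b) (\<tau> * c) (\<tau> * d - \<delta>)"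
    by (simp add: M_def mat2_mult assms(1,3)[symmetric] algebra_simps)
  have M3: "M ** M ** M = mat2 ((\<tau>\<^sup>2 - \<delta>) * a - \<tau> * \<delta>) ((\<tau>\<^sup>2 - \<delta>) * b) ((\<tau>\<^sup>2 - \<delta>) * c) ((\<tau>\<^sup>2 - \<delta>) * d - \<tau> * \<delta>)"
    unfolding M2 by (simp add: M_def mat2_mult assms(1,3)[symmetric] algebra_simps power2_eq_square)
  \<comment> \<open>For the fifth power \<open>M^3 M^2\<close> only the lower left entry is
    computed: a nonzero one already excludes a scalar matrix.\<close>
  define P where "P = M ** M ** M ** (M ** M)"
  have P: "P $ 2 $ 1 = (\<tau> ^ 4 - 3 * \<tau>\<^sup>2 * \<delta> + \<delta>\<^sup>2) * c"
    unfolding P_def M3 unfolding M2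
    by (simp add: mat2_mult assms(1,3)[symmetric] algebra_simps power2_eq_square power4_eq_xxxx)
  have nt: "proj_class A \<noteq> \<one>\<^bsub>PGL2\<^esub>" if "A $ 2 $ 1 \<noteq> 0" for A :: "'a ^ 2 ^ 2"
  proof -
    have "A = mat2 (A $ 1 $ 1) (A $ 1 $ 2) (A $ 2 $ 1) (A $ 2 $ 2)"
      by (simp add: vec_eq_iff forall_2)
    then show ?thesis using that proj_class_eq_one_iff by metis
  qed
  have "y [^]\<^bsub>PGL2\<^esub> (2::nat) = proj_class (M ** M)"
    using cl inv by (simp add: y_def M_def[symmetric] numeral_eq_Suc proj_class_mult)
  then show "y [^]\<^bsub>PGL2\<^esub> (2::nat) \<noteq> \<one>\<^bsub>PGL2\<^esub>"
    using nt[of "M ** M"] assms by (simp add: M2)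
  have "y [^]\<^bsub>PGL2\<^esub> (3::nat) = proj_class (M ** M ** M)"
    using cl inv by (simp add: y_def M_def[symmetric] numeral_eq_Suc proj_class_mult invertible_mult)
  then show "y [^]\<^bsub>PGL2\<^esub> (3::nat) \<noteq> \<one>\<^bsub>PGL2\<^esub>"
    using nt[of "M ** M ** M"] assms by (simp add: M3)
  have "y [^]\<^bsub>PGL2\<^esub> (5::nat) = proj_class P"
    using cl inv by (simp add: y_def M_def[symmetric] P_def numeral_eq_Suc proj_class_mult invertible_mult matrix_mul_assoc)
  then show "y [^]\<^bsub>PGL2\<^esub> (5::nat) \<noteq> \<one>\<^bsub>PGL2\<^esub>"
    using nt[of P] assms by (simp add: P)
qed

section \<open>Primitive tenth roots of unity and the golden ratio\<close>

text \<open>\<open>x^5\<close> is a square root of 1 other than 1. The quartic is the tenth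
  cyclotomic polynomial, the cofactor of \<open>x + 1\<close> in \<open>x^5 + 1\<close>. In
  characteristic 2 one would have \<open>x^5 = -1 = 1\<close>.\<close>

lemma primitive_root_of_unity_10:
  fixes x :: "'k::field"
  assumes "primitive_root_of_unity 10 x"
  shows "x \<noteq> 0" "x ^ 5 = -1" "x ^ 4 - x ^ 3 + x\<^sup>2 - x + 1 = 0" "(2::'k) \<noteq> 0"
proof -
  have x10: "x ^ 10 = 1" and ne: "\<And>m. 0 < m \<Longrightarrow> m < 10 \<Longrightarrow> x ^ m \<noteq> 1"
    using assms by (auto simp: primitive_root_of_unity_def)
  show "x \<noteq> 0" using x10 by auto
  have "(x ^ 5 - 1) * (x ^ 5 + 1) = 0"
    using x10 by (simp add: algebra_simps flip: power_add)
  then show x5: "x ^ 5 = -1"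
    using ne[of 5] by (simp add: eq_neg_iff_add_eq_0)
  have "(x + 1) * (x ^ 4 - x ^ 3 + x\<^sup>2 - x + 1) = x ^ 5 + 1"
    by (simp add: algebra_simps numeral_eq_Suc)
  moreover have "x + 1 \<noteq> 0"
    using ne[of 2] by (auto simp: add_eq_0_iff2)
  ultimately show "x ^ 4 - x ^ 3 + x\<^sup>2 - x + 1 = 0"
    using x5 by (metis add.left_inverse mult_eq_0_iff)
  show "(2::'k) \<noteq> 0"
  proof
    assume "(2::'k) = 0"
    then have "(-1::'k) = 1" by (metis add_eq_0_iff one_add_one)
    then show False using x5 ne[of 5] by simp
  qed
qed

text \<open>With the inverse written as a polynomial, later identities involve \<open>x\<close>
  alone and can be checked modulo the cyclotomic polynomial.\<close>

lemma inverse_primitive_root_of_unity_10: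
  fixes x :: "'k::field"
  assumes "primitive_root_of_unity 10 x"
  shows "inverse x = 1 - x + x\<^sup>2 - x ^ 3"
proof (rule inverse_unique)
  show "x * (1 - x + x\<^sup>2 - x ^ 3) = 1"
    using primitive_root_of_unity_10(3)[OF assms] by Groebner_Basis.algebra
qed

text \<open>Dividing the cyclotomic polynomial by \<open>x^2\<close> turns it into
  \<open>w^2 - w - 1\<close>.\<close>

lemma golden_ratio_primitive_root:
  fixes x :: "'k::field"
  assumes "primitive_root_of_unity 10 x" "w = x + inverse x"
  shows "w\<^sup>2 = w + 1"
proof -
  note x = primitive_root_of_unity_10[OF assms(1)]
  show ?thesis
    using x(3) unfolding assms(2) inverse_primitive_root_of_unity_10[OF assms(1)] by Groebner_Basis.algebra
qed

lemma power_ne_inverse_power: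
  fixes x :: "'k::field"
  assumes "primitive_root_of_unity 10 x" "0 < m" "m < 5"
  shows "x ^ m \<noteq> inverse x ^ m"
proof
  assume eq: "x ^ m = inverse x ^ m"
  have "x ^ (2 * m) = x ^ m * inverse x ^ m"
    unfolding eq[symmetric] by (simp add: mult_2 power_add)
  also have "\<dots> = 1"
    using primitive_root_of_unity_10[OF assms(1)] by (simp flip: power_mult_distrib)
  finally show False
    using assms by (auto simp: primitive_root_of_unity_def)
qed

section \<open>Klein's generators in PGL(2,K)\<close>

text \<open>\<open>v\<close> is the conjugate of the golden ratio \<open>x + y\<close>, that is, the
  other root of \<open>X^2 - X - 1\<close>. Each relation is a matrix identity up to an explicit
  scalar.\<close>

lemma icosahedral_PGL2:
  fixes x :: "'k::field"
  assumes x: "primitive_root_of_unity 10 x" and y: "y = inverse x" and v: "v = 1 - x - y"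
  defines "r \<equiv> proj_class (mat2 x 0 0 y)" and "t \<equiv> proj_class (mat2 (-v) x y v)"
    and "u \<equiv> proj_class (mat2 0 x (-y) 0)"
  shows "icosahedral_pair (alt_group 5) alt_r alt_t alt_u PGL2 r t u"
proof -
  note x' = primitive_root_of_unity_10[OF x]
  have xy: "x * y = 1" and nz: "x \<noteq> 0" "y \<noteq> 0" using x' y by simp_all
  have y5: "y ^ 5 = -1"
    using x'(2) by (simp add: y power_inverse)
  have y_poly: "y = 1 - x + x\<^sup>2 - x ^ 3"
    unfolding y by (rule inverse_primitive_root_of_unity_10[OF x])
  then have v_poly: "v = x ^ 3 - x\<^sup>2"
    by (simp add: v)
  note poly = y_poly v_poly
  have ne: "x \<noteq> y" "x\<^sup>2 \<noteq> y\<^sup>2" "x ^ 3 \<noteq> y ^ 3"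
    using power_ne_inverse_power[OF x, of 1] power_ne_inverse_power[OF x, of 2]
      power_ne_inverse_power[OF x, of 3] by (simp_all add: y)
  have "v\<^sup>2 = v + 1" using x'(3) unfolding poly by Groebner_Basis.algebra
  then have v0: "v \<noteq> 0" by auto
  \<comment> \<open>The determinant of the matrix of \<open>t\<close> is \<open>-(v^2 + 1)\<close>,
    which therefore equals \<open>(x - y)^2\<close>.\<close>
  have "v\<^sup>2 + 1 = - ((x - y)\<^sup>2)" using x'(3) unfolding poly by Groebner_Basis.algebra
  then have det_t0: "v\<^sup>2 + 1 \<noteq> 0" using ne by simp
  interpret PGL2: group "PGL2 :: ('k ^ 2 ^ 2) set monoid" by (rule group_PGL2)
  have pow: "r [^]\<^bsub>PGL2\<^esub> n = proj_class (mat2 (x ^ n) 0 0 (y ^ n))" for n :: nat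
    unfolding r_def by (rule mat2_diag_pow[OF nz])
  have inv: "invertible (mat2 (x ^ n) 0 0 (y ^ n))" "invertible (mat2 x 0 0 y)"
    "invertible (mat2 (-v) x y v)" "invertible (mat2 0 x (-y) 0)" for n
    using nz det_t0 xy minus_add_distrib[of "v * v" 1] neg_equal_0_iff_equal[of "v * v + 1"]
    by (simp_all add: invertible_mat2 power2_eq_square)
  note cls = mat2_diag_pow[OF nz] r_def t_def u_def proj_class_mult invertible_mult inv
  note mats = mat2_mult mat_mult_mat2 mat2_eq_iff
  have closed: "r \<in> carrier PGL2" "t \<in> carrier PGL2" "u \<in> carrier PGL2"
    unfolding r_def t_def u_def by (intro proj_class_closed inv)+
  have "icosahedral_triple PGL2 r t u"
  proof
    show "r \<in> carrier PGL2" "t \<in> carrier PGL2" "u \<in> carrier PGL2"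
      by (fact closed)+
    show "r [^]\<^bsub>PGL2\<^esub> (5::nat) = \<one>\<^bsub>PGL2\<^esub>"
      using nz by (simp add: pow proj_class_eq_one_iff x'(2) y5)
    show "t \<otimes>\<^bsub>PGL2\<^esub> t = \<one>\<^bsub>PGL2\<^esub>"
      unfolding t_def using inv det_t0 xy
      by (simp add: proj_class_mult mat2_mult proj_class_eq_one_iff power2_eq_square algebra_simps)
    show "u \<otimes>\<^bsub>PGL2\<^esub> u = \<one>\<^bsub>PGL2\<^esub>"
      unfolding u_def using inv nz
      by (simp add: proj_class_mult mat2_mult proj_class_eq_one_iff)
    \<comment> \<open>The two matrices anticommute, whence the scalar \<open>-1\<close>.\<close>
    show "u \<otimes>\<^bsub>PGL2\<^esub> t = t \<otimes>\<^bsub>PGL2\<^esub> u"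
      by (simp only: cls, rule proj_class_eqI[of _ "-1"]) (simp_all add: mats)
    show "u \<otimes>\<^bsub>PGL2\<^esub> r = r [^]\<^bsub>PGL2\<^esub> (4::nat) \<otimes>\<^bsub>PGL2\<^esub> u"
    proof -
      have powers: "x ^ 4 * x = -1" "y ^ 4 * y = -1" "y * x = 1"
        using x'(2) y5 xy by (simp_all add: numeral_eq_Suc mult.commute mult.left_commute)
      show ?thesis
        by (simp only: cls, rule proj_class_eqI[of _ "-1"]) (simp_all add: mats xy powers)
    qed
    \<comment> \<open>Here and in the next three relations the scalar is found by comparing upper
      right entries. On the left this entry is \<open>- v x (x^j - y^j)\<close>; on the right it is
      \<open>v x\<close> for \<open>j = 1, 4\<close> and \<open>x\<close> for
      \<open>j = 2, 3\<close>. For \<open>j = 4\<close> one uses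
      \<open>x^4 - y^4 = x - y\<close>.\<close>
    show "t \<otimes>\<^bsub>PGL2\<^esub> (r \<otimes>\<^bsub>PGL2\<^esub> t) =
        r \<otimes>\<^bsub>PGL2\<^esub> (t \<otimes>\<^bsub>PGL2\<^esub> (r [^]\<^bsub>PGL2\<^esub> (4::nat) \<otimes>\<^bsub>PGL2\<^esub> u))"
      by (simp only: cls, rule proj_class_eqI[symmetric, of _ "- (x - y)"])
        (simp only: mats poly, (intro conjI; use x'(3) in Groebner_Basis.algebra), use ne v0 in simp)
    show "t \<otimes>\<^bsub>PGL2\<^esub> (r [^]\<^bsub>PGL2\<^esub> (2::nat) \<otimes>\<^bsub>PGL2\<^esub> t) =
        r [^]\<^bsub>PGL2\<^esub> (3::nat) \<otimes>\<^bsub>PGL2\<^esub> (t \<otimes>\<^bsub>PGL2\<^esub> r [^]\<^bsub>PGL2\<^esub> (3::nat))"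
      by (simp only: cls, rule proj_class_eqI[symmetric, of _ "- (v * (x\<^sup>2 - y\<^sup>2))"])
        (simp only: mats poly, (intro conjI; use x'(3) in Groebner_Basis.algebra), use ne v0 in simp)
    show "t \<otimes>\<^bsub>PGL2\<^esub> (r [^]\<^bsub>PGL2\<^esub> (3::nat) \<otimes>\<^bsub>PGL2\<^esub> t) =
        r [^]\<^bsub>PGL2\<^esub> (2::nat) \<otimes>\<^bsub>PGL2\<^esub> (t \<otimes>\<^bsub>PGL2\<^esub> r [^]\<^bsub>PGL2\<^esub> (2::nat))"
      by (simp only: cls, rule proj_class_eqI[symmetric, of _ "- (v * (x ^ 3 - y ^ 3))"])
        (simp only: mats poly, (intro conjI; use x'(3) in Groebner_Basis.algebra), use ne v0 in simp)
    show "t \<otimes>\<^bsub>PGL2\<^esub> (r [^]\<^bsub>PGL2\<^esub> (4::nat) \<otimes>\<^bsub>PGL2\<^esub> t) =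
        r [^]\<^bsub>PGL2\<^esub> (4::nat) \<otimes>\<^bsub>PGL2\<^esub> (t \<otimes>\<^bsub>PGL2\<^esub> (r \<otimes>\<^bsub>PGL2\<^esub> u))"
      by (simp only: cls, rule proj_class_eqI[symmetric, of _ "- (x - y)"])
        (simp only: mats poly, (intro conjI; use x'(3) in Groebner_Basis.algebra), use ne v0 in simp)
  qed
  then interpret G: icosahedral_triple PGL2 r t u .
  show ?thesis
  proof
    show "bij_betw alt.bruhat bruhat_indices (carrier (alt_group 5))"
      by (rule bij_alt_bruhat)
    fix n assume n: "n \<in> bruhat_indices" and one: "G.bruhat n = \<one>\<^bsub>PGL2\<^esub>"
    obtain i e j f where ijn: "n = (i, e, j, f)" by (cases n)
    \<comment> \<open>In the first three kinds of words an off-diagonal entry is a product of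
      \<open>v\<close> and powers of \<open>x\<close> and \<open>y\<close>, or of such powers alone,
      up to sign, so it does not vanish. Pure powers of \<open>r\<close> are scalar only if
      \<open>x^j = y^j\<close>, which forces \<open>j = 0\<close>.\<close>
    consider "e" "f" | "e" "\<not> f" | "\<not> e" "f" | "\<not> e" "\<not> f" by blast
    then show "alt.bruhat n = \<one>\<^bsub>alt_group 5\<^esub>"
    proof cases
      case 1
      with one have "r [^]\<^bsub>PGL2\<^esub> i \<otimes>\<^bsub>PGL2\<^esub> (t \<otimes>\<^bsub>PGL2\<^esub> (r [^]\<^bsub>PGL2\<^esub> j \<otimes>\<^bsub>PGL2\<^esub> u)) = \<one>\<^bsub>PGL2\<^esub>"
        by (simp add: ijn)
      then show ?thesis
        using nz v0 by (simp only: cls) (simp add: mat2_mult proj_class_eq_one_iff)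
    next
      case 2
      with one have "r [^]\<^bsub>PGL2\<^esub> i \<otimes>\<^bsub>PGL2\<^esub> (t \<otimes>\<^bsub>PGL2\<^esub> r [^]\<^bsub>PGL2\<^esub> j) = \<one>\<^bsub>PGL2\<^esub>"
        by (simp add: ijn closed)
      then show ?thesis
        using nz v0 by (simp only: cls) (simp add: mat2_mult proj_class_eq_one_iff)
    next
      case 3
      with one n have "r [^]\<^bsub>PGL2\<^esub> j \<otimes>\<^bsub>PGL2\<^esub> u = \<one>\<^bsub>PGL2\<^esub>"
        by (simp add: ijn closed bruhat_indices_def)
      then show ?thesis
        using nz v0 by (simp only: cls) (simp add: mat2_mult proj_class_eq_one_iff)
    next
      case 4
      with one n have "r [^]\<^bsub>PGL2\<^esub> j = \<one>\<^bsub>PGL2\<^esub>" "i = 0" "j < 5"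
        by (simp_all add: ijn closed bruhat_indices_def)
      then have "x ^ j = inverse x ^ j" "i = 0" "j < 5"
        by (simp_all add: pow proj_class_eq_one_iff y)
      then have "j = 0"
        using power_ne_inverse_power[OF x] by blast
      then show ?thesis
        using 4 \<open>i = 0\<close> by (simp add: ijn)
    qed
  qed
qed

section \<open>Distinguishing the two cases by element orders\<close>

text \<open>In \<open>alt_group 5\<close> the second, third or fifth power of each element is
  trivial, and an isomorphism pulls this back to \<open>z\<close>.\<close>

lemma not_iso_alt_group_5:
  assumes "group G" "subgroup H G" "z \<in> H"
    and "\<And>k. k \<in> {2, 3, 5 :: nat} \<Longrightarrow> z [^]\<^bsub>G\<^esub> k \<noteq> \<one>\<^bsub>G\<^esub>"
  shows "\<not> G\<lparr>carrier := H\<rparr> \<cong> alt_group 5"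
proof
  assume "G\<lparr>carrier := H\<rparr> \<cong> alt_group 5"
  then obtain f where f: "f \<in> iso (G\<lparr>carrier := H\<rparr>) (alt_group 5)"
    by (auto simp: is_iso_def)
  interpret group G by (rule assms)
  interpret H: group "G\<lparr>carrier := H\<rparr>"
    using assms by (simp add: subgroup_imp_group)
  interpret f: group_hom "G\<lparr>carrier := H\<rparr>" "alt_group 5" f
    using f alt.group_axioms H.group_axioms by (simp add: group_hom_def group_hom_axioms_def iso_def)
  have z: "z \<in> carrier (G\<lparr>carrier := H\<rparr>)" using assms by simp
  obtain k :: nat where k: "k \<in> {2, 3, 5}" "f z [^]\<^bsub>alt_group 5\<^esub> k = \<one>\<^bsub>alt_group 5\<^esub>"
    using alt_group_5_orders[OF f.hom_closed[OF z]] by blast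
  then have "f (z [^]\<^bsub>G\<lparr>carrier := H\<rparr>\<^esub> k) = \<one>\<^bsub>alt_group 5\<^esub>"
    using f.hom_nat_pow[OF z] by simp
  moreover have "inj_on f (carrier (G\<lparr>carrier := H\<rparr>))"
    using f by (simp add: iso_def bij_betw_def)
  ultimately have "z [^]\<^bsub>G\<lparr>carrier := H\<rparr>\<^esub> k = \<one>\<^bsub>G\<lparr>carrier := H\<rparr>\<^esub>"
    using f.inj_on_one_iff H.nat_pow_closed[OF z] by blast
  then show False
    using assms(4)[OF k(1)] nat_pow_consistent[of z k H] by simp
qed

theorem proposition5p1:
  fixes p q :: nat
    and xi_kappa xi_lambda omega_kappa omega_lambda D eta :: "'k::field"
    and R S :: "'k ^ 2 ^ 2"
  assumes "prime p" and "odd p" and "p \<noteq> 5"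
    and "\<exists>e\<ge>1. q = p ^ e"
    and "algebraic_closure (field_ring :: 'k ring) (GF p)"
    and "primitive_root_of_unity 10 xi_kappa" and "xi_kappa \<in> GF q \<union> GF (q\<^sup>2)"
    and "primitive_root_of_unity 10 xi_lambda" and "xi_lambda \<in> GF q \<union> GF (q\<^sup>2)"
    and "omega_kappa = xi_kappa + inverse xi_kappa"
    and "omega_lambda = xi_lambda + inverse xi_lambda"
    and "D = omega_kappa\<^sup>2 + omega_lambda\<^sup>2 - 4"
    and "eta = inverse (xi_kappa - inverse xi_kappa)"
    and "R = vector [vector [xi_kappa, 0],
                     vector [0, inverse xi_kappa]]"
    and "S = mat eta ** vector [vector [- omega_lambda * inverse xi_kappa, - D],
                              vector [1, omega_lambda * xi_kappa]]"
  shows "rotation_group R S \<cong> alt_group 5 \<longleftrightarrow> omega_lambda \<noteq> omega_kappa"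
proof -
  define y where "y = inverse xi_kappa"
  define r where "r = proj_class (mat2 xi_kappa 0 0 y)"
  define S' where "S' = mat2 (- omega_lambda * y) (- D) 1 (omega_lambda * xi_kappa)"
  define s where "s = proj_class S'"
  note x = primitive_root_of_unity_10[OF assms(6)]
  have xy: "xi_kappa * y = 1" and nz: "xi_kappa \<noteq> 0" "y \<noteq> 0"
    using x(1) by (simp_all add: y_def)
  have ne: "xi_kappa \<noteq> y"
    using power_ne_inverse_power[OF assms(6), of 1] by (simp add: y_def)
  have w: "omega_kappa = xi_kappa + y" using assms by (simp add: y_def)
  have wk: "omega_kappa\<^sup>2 = omega_kappa + 1" and wl: "omega_lambda\<^sup>2 = omega_lambda + 1"
    using golden_ratio_primitive_root assms by blast+
  \<comment> \<open>The left side is the determinant of \<open>S'\<close>, so \<open>S'\<close> is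
    invertible; the factor \<open>eta\<close> normalises it to determinant 1.\<close>
  have det_S: "D - omega_lambda\<^sup>2 = (xi_kappa - y)\<^sup>2"
  proof -
    have "(xi_kappa + y)\<^sup>2 - 4 = (xi_kappa - y)\<^sup>2" using xy by Groebner_Basis.algebra
    then show ?thesis unfolding assms(12) w by simp
  qed
  have "- omega_lambda * y * (omega_lambda * xi_kappa) - - D * 1 = D - omega_lambda\<^sup>2 * (xi_kappa * y)"
    by Groebner_Basis.algebra
  also have "\<dots> \<noteq> 0"
    unfolding xy mult_1_right det_S using ne by simp
  finally have inv: "invertible S'" "invertible (mat2 xi_kappa 0 0 y)"
    using nz by (simp_all add: S'_def invertible_mat2)
  have cl: "r \<in> carrier PGL2" "s \<in> carrier PGL2"
    using inv by (simp_all add: r_def s_def proj_class_closed)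
  have eta: "eta \<noteq> 0" using ne assms by (simp add: y_def)
  have RS: "R = mat2 xi_kappa 0 0 y" "S = mat eta ** S'"
    using assms by (simp_all add: mat2_def S'_def y_def)
  have "proj_class R = r" "proj_class S = s"
    unfolding r_def s_def RS by (rule refl, rule proj_class_eqI[OF refl eta, symmetric])
  then have rot: "rotation_group R S = PGL2\<lparr>carrier := generate PGL2 {r, s}\<rparr>"
    by (simp add: rotation_group_def)
  \<comment> \<open>Both are roots of \<open>X^2 - X - 1\<close>, whose roots sum to 1, so they are
    equal or conjugate.\<close>
  have "(omega_lambda - omega_kappa) * (omega_lambda + omega_kappa - 1) = 0"
    using wk wl by Groebner_Basis.algebra
  then have "omega_lambda - omega_kappa = 0 \<or> omega_lambda + omega_kappa - 1 = 0"
    by simp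
  then consider "omega_lambda = omega_kappa"
    | "omega_lambda \<noteq> omega_kappa" "omega_lambda = 1 - xi_kappa - y"
    unfolding w diff_diff_add by (metis eq_iff_diff_eq_0 eq_diff_eq)
  then show ?thesis
  proof cases
    case 1
    \<comment> \<open>Since \<open>r\<close> has fifth power 1, this is the class of
      \<open>R^-1 S\<close>.\<close>
    define z where "z = r [^]\<^bsub>PGL2\<^esub> (4::nat) \<otimes>\<^bsub>PGL2\<^esub> s"
    interpret group "PGL2 :: ('k ^ 2 ^ 2) set monoid" by (rule group_PGL2)
    have sub: "subgroup (generate PGL2 {r, s}) PGL2"
      using cl by (intro generate_is_subgroup) auto
    have r_in: "r \<in> generate PGL2 {r, s}" and s_in: "s \<in> generate PGL2 {r, s}"
      by (auto intro: generate.incl)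
    have z_in: "z \<in> generate PGL2 {r, s}"
      unfolding z_def int_pow_int[symmetric]
      by (intro subgroup.m_closed[OF sub] subgroup_int_pow_closed sub r_in s_in)
    have y_poly: "y = 1 - xi_kappa + xi_kappa\<^sup>2 - xi_kappa ^ 3"
      unfolding y_def by (rule inverse_primitive_root_of_unity_10[OF assms(6)])
    have x4: "xi_kappa ^ 4 = - y" "y ^ 4 = - xi_kappa"
      unfolding y_poly using x(3) by Groebner_Basis.algebra+
    have z: "z = proj_class (mat2 (omega_kappa * y\<^sup>2) (y * D) (- xi_kappa) (- (omega_kappa * xi_kappa\<^sup>2)))"
      unfolding z_def r_def s_def mat2_diag_pow[OF nz] S'_def x4 1
      using inv nz by (subst proj_class_mult)
        (simp_all add: S'_def 1 invertible_mat2 mat2_mult power2_eq_square mult.commute mult.left_commute)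
    have "z [^]\<^bsub>PGL2\<^esub> k \<noteq> \<one>\<^bsub>PGL2\<^esub>" if "k \<in> {2, 3, 5 :: nat}" for k
    proof -
      \<comment> \<open>The chosen matrix for \<open>z\<close> has determinant \<open>e^2\<close>
        and trace \<open>- e omega_kappa^2\<close>. After dividing out powers of \<open>e\<close>,
        the conditions for nontrivial powers concern \<open>omega_kappa\<close> only.\<close>
      define e where "e = xi_kappa - y"
      have e: "e \<noteq> 0" using ne by (simp add: e_def)
      have w0: "omega_kappa \<noteq> 0" using wk by auto
      have w4: "omega_kappa ^ 4 \<noteq> 1"
      proof
        assume "omega_kappa ^ 4 = 1"
        \<comment> \<open>Now \<open>omega_kappa^2 = omega_kappa + 1\<close> would be 1 or -1. The
          first makes \<open>omega_kappa\<close> zero; the second makes it -2, so that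
          \<open>(xi_kappa - y)^2 = omega_kappa^2 - 4\<close> vanishes.\<close>
        then have "(omega_kappa\<^sup>2)\<^sup>2 = 1" by (simp flip: power_mult)
        then have "omega_kappa + 1 = 1 \<or> omega_kappa + 1 = -1"
          unfolding wk power2_eq_1_iff .
        then have "omega_kappa = -2" using w0 by (auto simp: eq_diff_eq[symmetric])
        then have "D - omega_lambda\<^sup>2 = 0" unfolding assms(12) by simp
        then show False using det_S e by (simp add: e_def)
      qed
      define \<tau> where "\<tau> = omega_kappa * y\<^sup>2 + - (omega_kappa * xi_kappa\<^sup>2)"
      have \<tau>: "\<tau> = - (e * omega_kappa\<^sup>2)"
        unfolding \<tau>_def e_def w by Groebner_Basis.algebra
      have det: "omega_kappa * y\<^sup>2 * - (omega_kappa * xi_kappa\<^sup>2) - y * D * - xi_kappa = e\<^sup>2"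
      proof -
        have "omega_kappa * y\<^sup>2 * - (omega_kappa * xi_kappa\<^sup>2) - y * D * - xi_kappa =
            (xi_kappa * y) * D - (xi_kappa * y)\<^sup>2 * omega_kappa\<^sup>2"
          by Groebner_Basis.algebra
        then show ?thesis using det_S by (simp add: xy 1 e_def)
      qed
      have "\<tau>\<^sup>2 = e\<^sup>2 * omega_kappa ^ 4" unfolding \<tau> by Groebner_Basis.algebra
      then have \<tau>2: "\<tau>\<^sup>2 \<noteq> e\<^sup>2" using w4 e by simp
      \<comment> \<open>By the golden ratio equation
        \<open>omega_kappa^4 = 3 omega_kappa + 2\<close> and
        \<open>omega_kappa^8 = 21 omega_kappa + 13\<close>. The factor 4 is split as
        \<open>2 * 2\<close> because 2 is known to be nonzero.\<close>
      have "omega_kappa ^ 8 - 3 * omega_kappa ^ 4 + 1 = 2 * 2 * omega_kappa ^ 4"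
        using wk by Groebner_Basis.algebra
      moreover have "\<tau> ^ 4 - 3 * \<tau>\<^sup>2 * e\<^sup>2 + (e\<^sup>2)\<^sup>2 =
          e ^ 4 * (omega_kappa ^ 8 - 3 * omega_kappa ^ 4 + 1)"
        unfolding \<tau> by Groebner_Basis.algebra
      ultimately have \<tau>4: "\<tau> ^ 4 - 3 * \<tau>\<^sup>2 * e\<^sup>2 + (e\<^sup>2)\<^sup>2 \<noteq> 0"
        using e w0 x(4) by (metis mult_eq_0_iff power_not_zero)
      have "e\<^sup>2 \<noteq> 0" using e by simp
      moreover have "- xi_kappa \<noteq> 0" using nz by simp
      moreover have "\<tau> \<noteq> 0" unfolding \<tau> using e w0 by simp
      ultimately have "proj_class (mat2 (omega_kappa * y\<^sup>2) (y * D) (- xi_kappa)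
          (- (omega_kappa * xi_kappa\<^sup>2))) [^]\<^bsub>PGL2\<^esub> k \<noteq> \<one>\<^bsub>PGL2\<^esub>"
        using that proj_class_powers_ne_one[OF det _ \<tau>_def[symmetric] _ _ \<tau>2 \<tau>4] by blast
      then show ?thesis
        unfolding z .
    qed
    then show ?thesis
      using not_iso_alt_group_5[OF group_PGL2 sub z_in] 1 by (simp add: rot)
  next
    case 2
    define t where "t = proj_class (mat2 (- omega_lambda) xi_kappa y omega_lambda)"
    interpret icosahedral_pair "alt_group 5" alt_r alt_t alt_u PGL2 r t
      "proj_class (mat2 0 xi_kappa (- y) 0)"
      unfolding r_def t_def by (rule icosahedral_PGL2[OF assms(6) y_def 2(2)])
    \<comment> \<open>For conjugate values \<open>D = -1\<close>, and then the product of the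
      matrices of \<open>r\<close> and \<open>s\<close> is exactly Klein's involution with
      \<open>v = omega_lambda\<close>.\<close>
    have "omega_lambda = 1 - omega_kappa" using 2 w by simp
    then have "D = -1"
      using wk unfolding assms(12) by (simp add: power2_diff)
    moreover have "y * xi_kappa = 1"
      using xy by (simp add: mult.commute)
    ultimately have "t = r \<otimes>\<^bsub>PGL2\<^esub> s"
      using inv xy unfolding r_def s_def t_def
      by (simp add: proj_class_mult) (simp add: S'_def mat2_mult mult.left_commute)
    then show ?thesis
      using generate_iso[OF cl(2)] 2 by (simp add: rot)
  qed
qed

end
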